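(* Let $G$ be a group, let $n\ge 1$, and let $R_1,\ldots,R_n$ be normal subgroups of $G$. Then the fat commutator subgroup and the symmetric commutator subgroup coincide: $$[[R_1,R_2,\ldots,R_n]]=[[R_1,R_2],\ldots,R_n]_S.$$
   Context: Commutators: $[a,b]=a^{-1}b^{-1}ab$. Bracket arrangements: a bracket arrangement of weight $n$ in a group $G$ is a map $\beta^n\colon G^n\to G$ defined inductively as follows. $\beta^1=\mathrm{id}_G$ and $\beta^2(a_1,a_2)=[a_1,a_2]$. For $n\ge 3$, a map $\beta^n\colon G^n\to G$ is a bracket arrangement of weight $n$ if it is the composite $G^n=G^k\times G^{n-k}\xrightarrow{\beta^k\times\beta^{n-k}}G\times G\xrightarrow{\beta^2}G$ for some $1\le k<n$ and some bracket arrangements $\beta^k,\beta^{n-k}$ of weights $k$ and $n-k$. Fat commutator subgroup: for subgroups $R_1,\ldots,R_n$ of $G$, $[[R_1,R_2,\ldots,R_n]]$ is the subgroup of $G$ generated by all commutators $\beta^t(g_{i_1},\ldots,g_{i_t})$ where (1) $1\le i_s\le n$; (2) $\{i_1,\ldots,i_t\}=\{1,\ldots,n\}$, i.e. each integer in $\{1,\ldots,n\}$ appears as at least one of the $i_s$; (3) $g_j\in R_j$; (4) $\beta^t$ runs over all bracket arrangements of weight $t$, with $t\ge n$. For $n=1$, $[[R_1]]=R_1$ by convention. Symmetric commutator subgroup: $$[[R_1,R_2],\ldots,R_n]_S=\prod_{\sigma\in\Sigma_n}[[R_{\sigma(1)},R_{\sigma(2)}],\ldots,R_{\sigma(n)}],$$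 where $\Sigma_n$ is the symmetric group on $\{1,\ldots,n\}$ and $[[R_{\sigma(1)},R_{\sigma(2)}],\ldots,R_{\sigma(n)}]$ is the subgroup generated by the left iterated commutators $[[[g_1,g_2],g_3],\ldots,g_n]$ with $g_i\in R_{\sigma(i)}$. For $n=1$, $[R_1]_S=R_1$ by convention. (For normal $R_i$ each factor is normal in $G$, so the product is a normal subgroup independent of the order of the factors.) *)

theory Defs
  imports "HOL-Algebra.Algebra" "HOL-Combinatorics.Permutations"
begin

definition commutator :: "('a, 'b) monoid_scheme \<Rightarrow> 'a \<Rightarrow> 'a \<Rightarrow> 'a" where
  "commutator G a b = inv\<^bsub>G\<^esub> a \<otimes>\<^bsub>G\<^esub> inv\<^bsub>G\<^esub> b \<otimes>\<^bsub>G\<^esub> a \<otimes>\<^bsub>G\<^esub> b"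

text \<open>
  A point of \<open>G\<^sup>n\<close> is a list of length \<open>n\<close>; the value of a weight-\<open>n\<close> arrangement on lists
  of any other length is irrelevant. The splitting \<open>G\<^sup>n = G\<^sup>k \<times> G\<^sup>n\<^sup>-\<^sup>k\<close> is \<open>take k\<close>, \<open>drop k\<close>.
\<close>

inductive bracket_arrangement :: "('a, 'b) monoid_scheme \<Rightarrow> nat \<Rightarrow> ('a list \<Rightarrow> 'a) \<Rightarrow> bool"
  for G where
  weight_one: "bracket_arrangement G 1 (\<lambda>xs. xs ! 0)"
| weight_two: "bracket_arrangement G 2 (\<lambda>xs. commutator G (xs ! 0) (xs ! 1))"
| composite: "\<lbrakk>n \<ge> 3; 1 \<le> k; k < n;
     bracket_arrangement G k \<beta>; bracket_arrangement G (n - k) \<gamma>\<rbrakk>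
   \<Longrightarrow> bracket_arrangement G n (\<lambda>xs. commutator G (\<beta> (take k xs)) (\<gamma> (drop k xs)))"

text \<open>
  The \<open>s\<close>-th entry \<open>g s\<close> is an arbitrary element of \<open>R (i s)\<close>: an index that is used
  several times may contribute a different element of the same subgroup each time.
\<close>

definition fat_commutator_subgroup ::
    "('a, 'b) monoid_scheme \<Rightarrow> nat \<Rightarrow> (nat \<Rightarrow> 'a set) \<Rightarrow> 'a set" where
  "fat_commutator_subgroup G n R =
     (if n = 1 then R 1
      else generate G {\<beta> (map g [1..<Suc t]) | \<beta> t i g.
             t \<ge> n \<and> bracket_arrangement G t \<beta> \<and>
             i ` {1..t} = {1..n} \<and> (\<forall>s\<in>{1..t}. g s \<in> R (i s))})"

definition left_commutator_subgroup ::
    "('a, 'b) monoid_scheme \<Rightarrow> nat \<Rightarrow> (nat \<Rightarrow> 'a set) \<Rightarrow> 'a set" where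
  "left_commutator_subgroup G n R =
     generate G {foldl (commutator G) (g 1) (map g [2..<Suc n]) | g. \<forall>i\<in>{1..n}. g i \<in> R i}"

text \<open>
  Normal subgroups form a commutative monoid under the product \<open>HK\<close>, so that a product over a
  finite index set is a \<open>finprod\<close> in this monoid and needs no order of the factors.
\<close>

definition normal_subgroup_monoid :: "('a, 'b) monoid_scheme \<Rightarrow> 'a set monoid" where
  "normal_subgroup_monoid G =
     \<lparr>carrier = {N. N \<lhd> G}, monoid.mult = (<#>\<^bsub>G\<^esub>), one = {\<one>\<^bsub>G\<^esub>}\<rparr>"

definition symmetric_commutator_subgroup ::
    "('a, 'b) monoid_scheme \<Rightarrow> nat \<Rightarrow> (nat \<Rightarrow> 'a set) \<Rightarrow> 'a set" where
  "symmetric_commutator_subgroup G n R =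
     (if n = 1 then R 1
      else finprod (normal_subgroup_monoid G)
             (\<lambda>\<sigma>. left_commutator_subgroup G n (\<lambda>i. R (\<sigma> i))) {\<sigma>. \<sigma> permutes {1..n}})"

text \<open>
  The remaining facts show that this \<open>finprod\<close> is well defined for normal \<open>R i\<close> and is the
  product of the factors, taken in any order.
\<close>

lemma (in group) comm_monoid_normal_subgroups: "comm_monoid (normal_subgroup_monoid G)"
proof (rule comm_monoidI)
  have sub: "N \<subseteq> carrier G" if "N \<lhd> G" for N
    using that normal_imp_subgroup subgroup.subset by blast
  fix x y z
  show "x \<otimes>\<^bsub>normal_subgroup_monoid G\<^esub> y \<in> carrier (normal_subgroup_monoid G)"
    if "x \<in> carrier (normal_subgroup_monoid G)" "y \<in> carrier (normal_subgroup_monoid G)"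
    using that normal_subgroup_set_mult_closed by (simp add: normal_subgroup_monoid_def)
  show "\<one>\<^bsub>normal_subgroup_monoid G\<^esub> \<in> carrier (normal_subgroup_monoid G)"
    by (simp add: normal_subgroup_monoid_def one_is_normal)
  show "x \<otimes>\<^bsub>normal_subgroup_monoid G\<^esub> y \<otimes>\<^bsub>normal_subgroup_monoid G\<^esub> z =
        x \<otimes>\<^bsub>normal_subgroup_monoid G\<^esub> (y \<otimes>\<^bsub>normal_subgroup_monoid G\<^esub> z)"
    if "x \<in> carrier (normal_subgroup_monoid G)" "y \<in> carrier (normal_subgroup_monoid G)"
       "z \<in> carrier (normal_subgroup_monoid G)"
    using that sub by (simp add: normal_subgroup_monoid_def set_mult_assoc)
  show "\<one>\<^bsub>normal_subgroup_monoid G\<^esub> \<otimes>\<^bsub>normal_subgroup_monoid G\<^esub> x = x"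
    if "x \<in> carrier (normal_subgroup_monoid G)"
    using that sub by (force simp: normal_subgroup_monoid_def set_mult_def)
  show "x \<otimes>\<^bsub>normal_subgroup_monoid G\<^esub> y = y \<otimes>\<^bsub>normal_subgroup_monoid G\<^esub> x"
    if "x \<in> carrier (normal_subgroup_monoid G)" "y \<in> carrier (normal_subgroup_monoid G)"
    using that commut_normal normal_imp_subgroup by (auto simp: normal_subgroup_monoid_def)
qed

lemma (in group) commutator_closed:
  "\<lbrakk>a \<in> carrier G; b \<in> carrier G\<rbrakk> \<Longrightarrow> commutator G a b \<in> carrier G"
  by (simp add: commutator_def)

lemma (in group) foldl_commutator_closed:
  "\<lbrakk>a \<in> carrier G; set xs \<subseteq> carrier G\<rbrakk> \<Longrightarrow> foldl (commutator G) a xs \<in> carrier G"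
  by (induction xs arbitrary: a) (auto simp: commutator_closed)

lemma (in group) commutator_conj:
  assumes "x \<in> carrier G" "a \<in> carrier G" "b \<in> carrier G"
  shows "x \<otimes> commutator G a b \<otimes> inv x =
    commutator G (x \<otimes> a \<otimes> inv x) (x \<otimes> b \<otimes> inv x)"
proof -
  have "inv x \<otimes> (x \<otimes> c) = c" if "c \<in> carrier G" for c
    using assms that by (simp flip: m_assoc)
  then show ?thesis
    using assms by (simp add: commutator_def inv_mult_group m_assoc)
qed

lemma (in group) foldl_commutator_conj:
  assumes "x \<in> carrier G" "a \<in> carrier G" "set ys \<subseteq> carrier G"
  shows "x \<otimes> foldl (commutator G) a ys \<otimes> inv x =
    foldl (commutator G) (x \<otimes> a \<otimes> inv x) (map (\<lambda>y. x \<otimes> y \<otimes> inv x) ys)"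
  using assms
  by (induction ys arbitrary: a) (simp_all add: commutator_closed commutator_conj)

lemma (in group) left_commutator_subgroup_normal:
  assumes "n \<ge> 1" and R: "\<And>i. i \<in> {1..n} \<Longrightarrow> R i \<lhd> G"
  shows "left_commutator_subgroup G n R \<lhd> G"
  unfolding left_commutator_subgroup_def
proof (rule normal_generateI)
  let ?S = "{foldl (commutator G) (g 1) (map g [2..<Suc n]) | g. \<forall>i\<in>{1..n}. g i \<in> R i}"
  have carr: "g i \<in> carrier G" if "\<forall>i\<in>{1..n}. g i \<in> R i" "i \<in> {1..n}" for g i
    using that R normal_imp_subgroup subgroup.mem_carrier by metis
  show "?S \<subseteq> carrier G"
    using carr \<open>n \<ge> 1\<close> by (auto intro!: foldl_commutator_closed simp del: upt_Suc)
  fix h x assume "h \<in> ?S" and x: "x \<in> carrier G"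
  then obtain g where h: "h = foldl (commutator G) (g 1) (map g [2..<Suc n])"
    and g: "\<forall>i\<in>{1..n}. g i \<in> R i" by blast
  define g' where "g' = (\<lambda>i. x \<otimes> g i \<otimes> inv x)"
  have "x \<otimes> h \<otimes> inv x = foldl (commutator G) (g' 1) (map g' [2..<Suc n])"
    unfolding h g'_def using carr[OF g] \<open>n \<ge> 1\<close>
    by (subst foldl_commutator_conj[OF x]) (auto simp: comp_def simp del: upt_Suc)
  moreover have "\<forall>i\<in>{1..n}. g' i \<in> R i"
    using g R x by (auto simp: g'_def intro: normal.inv_op_closed2)
  ultimately show "x \<otimes> h \<otimes> inv x \<in> ?S" by blast
qed

lemma (in group) symmetric_commutator_subgroup_eq_product:
  assumes "n > 1" and R: "\<And>i. i \<in> {1..n} \<Longrightarrow> R i \<lhd> G"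
    and "distinct ps" "set ps = {\<sigma>. \<sigma> permutes {1..n}}"
  shows "symmetric_commutator_subgroup G n R =
    foldr (\<lambda>\<sigma> P. left_commutator_subgroup G n (\<lambda>i. R (\<sigma> i)) <#> P) ps {\<one>}"
proof -
  interpret M: comm_monoid "normal_subgroup_monoid G" by (rule comm_monoid_normal_subgroups)
  let ?F = "\<lambda>\<sigma>. left_commutator_subgroup G n (\<lambda>i. R (\<sigma> i))"
  have F: "?F \<sigma> \<in> carrier (normal_subgroup_monoid G)" if "\<sigma> permutes {1..n}" for \<sigma>
    using left_commutator_subgroup_normal[of n "\<lambda>i. R (\<sigma> i)"] R assms(1) permutes_in_image[OF that]
    by (simp add: normal_subgroup_monoid_def)
  have "finprod (normal_subgroup_monoid G) ?F (set qs) = foldr (\<lambda>\<sigma> P. ?F \<sigma> <#> P) qs {\<one>}"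
    if "distinct qs" "set qs \<subseteq> {\<sigma>. \<sigma> permutes {1..n}}" for qs
    using that
  proof (induction qs)
    case Nil
    have "finprod (normal_subgroup_monoid G) ?F {} = \<one>\<^bsub>normal_subgroup_monoid G\<^esub>"
      by (rule M.finprod_empty)
    also have "\<dots> = {\<one>}" by (simp add: normal_subgroup_monoid_def)
    finally show ?case by simp
  next
    case (Cons q qs)
    then have "finprod (normal_subgroup_monoid G) ?F (set (q # qs)) =
        ?F q \<otimes>\<^bsub>normal_subgroup_monoid G\<^esub> finprod (normal_subgroup_monoid G) ?F (set qs)"
      using F by (simp, subst M.finprod_insert) auto
    then show ?case using Cons by (simp add: normal_subgroup_monoid_def)
  qed
  from this[of ps] show ?thesis
    using assms(1,3,4) by (simp add: symmetric_commutator_subgroup_def)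
qed

end

theory Submission
  imports Defs
begin

text \<open>
  For a finite set \<open>I\<close> of indices let \<open>S(I)\<close> be the subgroup generated by the left-normed
  commutators \<open>[[r\<^sub>1, r\<^sub>2], \<dots>, r\<^sub>k]\<close> whose entries come from the subgroups \<open>R j\<close>, \<open>j \<in> I\<close>, each
  index being used exactly once, in any order. As the \<open>R j\<close> are normal, \<open>S(I)\<close> is normal.

  The heart of the proof is the inclusion \<open>[S(I), S(J)] \<subseteq> S(I \<union> J)\<close>, where \<open>I\<close> and \<open>J\<close> may overlap
  (\<open>commutator_mem_sym_comm\<close>). If \<open>J\<close> is a single index \<open>j \<notin> I\<close>, a commutator with an element of
  \<open>R j\<close> only lengthens the left-normed commutators by one entry; if \<open>j \<in> I\<close>, it stays in \<open>S(I)\<close> by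
  normality, so that a repeated index may be dropped. For larger \<open>J\<close>, a left-normed
  commutator over \<open>J\<close> has the form \<open>[u, v]\<close> with \<open>v \<in> R j\<close> and \<open>u\<close> left-normed over
  \<open>J - {j}\<close>, and the Hall-Witt identity trades \<open>[x, [u, v]]\<close> for commutators of the shapes
  \<open>[[x, u], v]\<close> and \<open>[[x, v], u]\<close>, up to inverses of entries and conjugation. In these, \<open>x\<close> only
  ever meets \<open>u\<close> and \<open>v\<close> one at a time, and both are shorter than \<open>[u, v]\<close>.

  Since a bracket arrangement is built by forming commutators of smaller ones, its value at
  elements of \<open>R (i 1), \<dots>, R (i t)\<close> then lies in \<open>S({i 1, \<dots>, i t})\<close>. Hence the fat commutator
  subgroup is contained in \<open>S({1..n})\<close>, which is contained in the symmetric commutator subgroup. The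
  converse inclusion holds because left-normed commutators are themselves bracket arrangements, so
  that the fat commutator subgroup contains every factor of the product over all permutations.
\<close>


section \<open>Commutators modulo a normal subgroup\<close>

context group
begin

lemma inv_mult_cancel_left:
  "\<lbrakk>a \<in> carrier G; b \<in> carrier G\<rbrakk> \<Longrightarrow> inv a \<otimes> (a \<otimes> b) = b"
  by (simp flip: m_assoc)

lemma mult_inv_cancel_left:
  "\<lbrakk>a \<in> carrier G; b \<in> carrier G\<rbrakk> \<Longrightarrow> a \<otimes> (inv a \<otimes> b) = b"
  by (simp flip: m_assoc)

lemmas group_word_simps =
  commutator_def inv_mult_group m_assoc inv_mult_cancel_left mult_inv_cancel_left

lemma inv_commutator:
  "\<lbrakk>a \<in> carrier G; b \<in> carrier G\<rbrakk> \<Longrightarrow> inv (commutator G a b) = commutator G b a"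
  by (simp add: group_word_simps)

lemma commutator_mult_left:
  "\<lbrakk>a \<in> carrier G; b \<in> carrier G; c \<in> carrier G\<rbrakk> \<Longrightarrow>
    commutator G (a \<otimes> b) c = inv b \<otimes> commutator G a c \<otimes> b \<otimes> commutator G b c"
  by (simp add: group_word_simps)

lemma commutator_inv_left:
  "\<lbrakk>a \<in> carrier G; c \<in> carrier G\<rbrakk> \<Longrightarrow>
    commutator G (inv a) c = a \<otimes> inv (commutator G a c) \<otimes> inv a"
  by (simp add: group_word_simps)

text \<open>
  The identity is solved for \<open>[[u, v], x]\<close>. Its inverses are placed so that \<open>u\<close> is not inverted where
  it is the outer entry: there \<open>u\<close> will be a left-normed commutator, and its inverse need not be one.
\<close>
lemma Hall_Witt:
  assumes "x \<in> carrier G" "u \<in> carrier G" "v \<in> carrier G"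
  shows "commutator G (commutator G u v) x =
    inv v \<otimes> inv (inv u \<otimes> commutator G (commutator G x (inv u)) (inv v) \<otimes> u) \<otimes>
    inv (inv x \<otimes> commutator G (commutator G (inv v) (inv x)) u \<otimes> x) \<otimes> v"
  using assms by (simp add: group_word_simps)

lemma normal_mem_carrier: "\<lbrakk>N \<lhd> G; a \<in> N\<rbrakk> \<Longrightarrow> a \<in> carrier G"
  by (rule subgroup.mem_carrier[OF normal_imp_subgroup])

lemma normal_inv_mem: "\<lbrakk>N \<lhd> G; a \<in> N\<rbrakk> \<Longrightarrow> inv a \<in> N"
  by (rule subgroup.m_inv_closed[OF normal_imp_subgroup])

lemma commutator_mem_normal_swap:
  assumes "K \<lhd> G" "a \<in> carrier G" "b \<in> carrier G" "commutator G a b \<in> K"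
  shows "commutator G b a \<in> K"
  using assms inv_commutator normal_imp_subgroup subgroup.m_inv_closed by metis

text \<open>
  The commutator of \<open>a\<close> and \<open>b\<close> is the product of \<open>inv a\<close> with a conjugate of \<open>a\<close>.
\<close>
lemma commutator_mem_normal_left:
  assumes "K \<lhd> G" "a \<in> K" "b \<in> carrier G"
  shows "commutator G a b \<in> K"
proof -
  interpret K: normal K G by fact
  have "inv a \<otimes> (inv b \<otimes> a \<otimes> b) \<in> K"
    using assms by (simp add: K.inv_op_closed1)
  then show ?thesis using assms by (simp add: commutator_def m_assoc)
qed

text \<open>
  The elements commuting with a fixed \<open>c\<close> modulo \<open>K\<close> are the preimage of a centralizer in the
  quotient by \<open>K\<close>, hence form a subgroup.
\<close>
lemma commutator_generate_mem_normal:
  assumes K: "K \<lhd> G" and A: "A \<subseteq> carrier G" and c: "c \<in> carrier G"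
    and gen: "\<And>a. a \<in> A \<Longrightarrow> commutator G a c \<in> K"
    and x: "x \<in> generate G A"
  shows "commutator G x c \<in> K"
proof -
  interpret K: normal K G by fact
  have inv_left: "commutator G (inv a) c \<in> K" if "a \<in> carrier G" "commutator G a c \<in> K" for a
    using that c by (simp add: commutator_inv_left K.inv_op_closed2)
  show ?thesis
    using x
  proof (induction rule: generate.induct)
    case one
    then show ?case using c by (simp add: commutator_def)
  next
    case (incl h)
    then show ?case by (rule gen)
  next
    case (inv h)
    then show ?case using A gen by (auto intro: inv_left)
  next
    case (eng h1 h2)
    then have "h1 \<in> carrier G" "h2 \<in> carrier G"
      using A generate_in_carrier by auto
    then show ?case
      using eng.IH c by (simp add: commutator_mult_left K.inv_op_closed1)
  qed
qed

lemma commutator_inv_left_mem_normal: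
  assumes "K \<lhd> G" "a \<in> carrier G" "c \<in> carrier G" "commutator G a c \<in> K"
  shows "commutator G (inv a) c \<in> K"
  using commutator_generate_mem_normal[of K "{a}" c "inv a"] assms
  by (auto intro: generate.inv)

lemma three_subgroup_mem:
  assumes "K \<lhd> G" "x \<in> carrier G" "u \<in> carrier G" "v \<in> carrier G"
    and "commutator G (commutator G x (inv u)) (inv v) \<in> K"
    and "commutator G (commutator G (inv v) (inv x)) u \<in> K"
  shows "commutator G (commutator G u v) x \<in> K"
proof -
  interpret K: normal K G by fact
  let ?p = "inv u \<otimes> commutator G (commutator G x (inv u)) (inv v) \<otimes> u"
  let ?q = "inv x \<otimes> commutator G (commutator G (inv v) (inv x)) u \<otimes> x"
  have p: "?p \<in> K" and q: "?q \<in> K"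
    using assms by (simp_all add: K.inv_op_closed1)
  then have "inv v \<otimes> (inv ?p \<otimes> inv ?q) \<otimes> v \<in> K"
    using assms by (intro K.inv_op_closed1) auto
  moreover have "?p \<in> carrier G" "?q \<in> carrier G"
    using p q K.subset by blast+
  then have "inv v \<otimes> (inv ?p \<otimes> inv ?q) \<otimes> v = inv v \<otimes> inv ?p \<otimes> inv ?q \<otimes> v"
    using assms(4) by (simp only: m_assoc inv_closed m_closed)
  ultimately show ?thesis
    using Hall_Witt[OF assms(2-4)] by simp
qed

end


section \<open>The subgroups generated by left-normed commutators\<close>

text \<open>
  Growing a left-normed commutator one entry at a time, and recording only the set of indices used so
  far, avoids any bookkeeping of their order. The condition \<open>j \<notin> I\<close> makes every index occur
  exactly once.
\<close>
inductive left_normed ::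
    "('a, 'b) monoid_scheme \<Rightarrow> ('i \<Rightarrow> 'a set) \<Rightarrow> 'i set \<Rightarrow> 'a \<Rightarrow> bool"
  for G R where
  single: "r \<in> R j \<Longrightarrow> left_normed G R {j} r"
| extend: "\<lbrakk>left_normed G R I x; j \<notin> I; r \<in> R j\<rbrakk>
   \<Longrightarrow> left_normed G R (insert j I) (commutator G x r)"

definition sym_comm :: "('a, 'b) monoid_scheme \<Rightarrow> ('i \<Rightarrow> 'a set) \<Rightarrow> 'i set \<Rightarrow> 'a set" where
  "sym_comm G R I = generate G {x. left_normed G R I x}"

lemma left_normed_mem_sym_comm: "left_normed G R I x \<Longrightarrow> x \<in> sym_comm G R I"
  by (simp add: sym_comm_def generate.incl)

context group
begin

lemma left_normed_closed:
  "left_normed G R I x \<Longrightarrow> (\<And>i. i \<in> I \<Longrightarrow> R i \<lhd> G) \<Longrightarrow> x \<in> carrier G"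
proof (induction rule: left_normed.induct)
  case (single r j)
  then show ?case by (simp add: normal_mem_carrier[of "R j"])
next
  case (extend I x j r)
  then have "r \<in> carrier G" by (simp add: normal_mem_carrier[of "R j"])
  with extend show ?case by (simp add: commutator_closed)
qed

text \<open>
  Conjugation acts entrywise on a commutator and preserves each normal subgroup \<open>R i\<close>; this is what
  makes the subgroup generated by the left-normed commutators normal.
\<close>
lemma left_normed_conj:
  assumes "left_normed G R I x" "\<And>i. i \<in> I \<Longrightarrow> R i \<lhd> G" "y \<in> carrier G"
  shows "left_normed G R I (y \<otimes> x \<otimes> inv y)"
  using assms
proof (induction rule: left_normed.induct)
  case (single r j)
  then show ?case by (simp add: left_normed.single normal.inv_op_closed2)
next
  case (extend I x j r)
  have "r \<in> carrier G" using extend by (simp add: normal_mem_carrier[of "R j"])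
  moreover have "x \<in> carrier G"
    by (rule left_normed_closed[OF extend.hyps(1)]) (simp add: extend.prems)
  moreover have "y \<otimes> r \<otimes> inv y \<in> R j" using extend by (simp add: normal.inv_op_closed2)
  ultimately show ?case
    using extend by (simp add: commutator_conj left_normed.extend)
qed

lemma sym_comm_normal:
  assumes "\<And>i. i \<in> I \<Longrightarrow> R i \<lhd> G"
  shows "sym_comm G R I \<lhd> G"
  unfolding sym_comm_def
proof (rule normal_generateI)
  show "{x. left_normed G R I x} \<subseteq> carrier G"
    using left_normed_closed[of R I] assms by auto
qed (simp add: left_normed_conj assms)

text \<open>
  A new index lengthens each generator by one entry, while an index that occurs already is
  absorbed because \<open>sym_comm G R I\<close> is normal.
\<close>
lemma commutator_mem_sym_comm_insert:
  assumes R: "\<And>i. i \<in> insert j I \<Longrightarrow> R i \<lhd> G"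
    and x: "x \<in> sym_comm G R I" and r: "r \<in> R j"
  shows "commutator G x r \<in> sym_comm G R (insert j I)"
proof -
  have "R j \<lhd> G" by (rule R) simp
  then have rc: "r \<in> carrier G" using r by (rule normal_mem_carrier)
  show ?thesis
  proof (cases "j \<in> I")
    case True
    then have "insert j I = I" by auto
    then show ?thesis
      using commutator_mem_normal_left[OF sym_comm_normal x rc] R by simp
  next
    case False
    show ?thesis
    proof (rule commutator_generate_mem_normal[OF sym_comm_normal _ rc])
      show "{x. left_normed G R I x} \<subseteq> carrier G"
        using left_normed_closed[of R I] R by auto
      show "x \<in> generate G {x. left_normed G R I x}" using x by (simp add: sym_comm_def)
    qed (use r False in \<open>auto intro: R left_normed_mem_sym_comm left_normed.extend\<close>)
  qed
qed

text \<open>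
  Induction on the length of the left-normed commutator \<open>y\<close>; the set \<open>I\<close> must be arbitrary because
  the second term of the Hall-Witt identity moves the last index of \<open>y\<close> into \<open>I\<close>.
\<close>
lemma commutator_left_normed_mem_sym_comm:
  assumes "left_normed G R J y" "\<And>i. i \<in> I \<union> J \<Longrightarrow> R i \<lhd> G" "x \<in> sym_comm G R I"
  shows "commutator G x y \<in> sym_comm G R (I \<union> J)"
  using assms
proof (induction arbitrary: I x rule: left_normed.induct)
  case (single r j)
  then show ?case using commutator_mem_sym_comm_insert[of j I R x r] by simp
next
  case (extend J u j v)
  let ?K = "sym_comm G R (I \<union> insert j J)"
  have K: "?K \<lhd> G" and IK: "sym_comm G R I \<lhd> G" and IJK: "sym_comm G R (I \<union> J) \<lhd> G"
    and IjK: "sym_comm G R (insert j I) \<lhd> G"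
    by (rule sym_comm_normal, rule extend.prems(1), auto)+
  have Rj: "R j \<lhd> G" by (rule extend.prems(1)) simp
  have x: "x \<in> carrier G" using IK extend.prems(2) by (rule normal_mem_carrier)
  have u: "u \<in> carrier G"
    by (rule left_normed_closed[OF extend.hyps(1)], rule extend.prems(1)) simp
  have v: "v \<in> carrier G" using Rj extend.hyps(3) by (rule normal_mem_carrier)
  have inv_v: "inv v \<in> R j" using Rj extend.hyps(3) by (rule normal_inv_mem)
  have inv_x: "inv x \<in> sym_comm G R I" using IK extend.prems(2) by (rule normal_inv_mem)
  have "commutator G x u \<in> sym_comm G R (I \<union> J)"
    by (rule extend.IH) (simp_all add: extend.prems)
  then have "commutator G x (inv u) \<in> sym_comm G R (I \<union> J)"
    using IJK x u
    by (intro commutator_mem_normal_swap[OF IJK _ _ commutator_inv_left_mem_normal[OF IJK]]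
      commutator_mem_normal_swap[OF IJK x u]) auto
  then have 1: "commutator G (commutator G x (inv u)) (inv v) \<in> ?K"
    using commutator_mem_sym_comm_insert[of j "I \<union> J" R _ "inv v"] extend.prems inv_v by auto
  have "commutator G (inv x) (inv v) \<in> sym_comm G R (insert j I)"
    using commutator_mem_sym_comm_insert[of j I R "inv x" "inv v"] extend.prems inv_v inv_x by auto
  then have "commutator G (inv v) (inv x) \<in> sym_comm G R (insert j I)"
    using IjK x v by (simp add: commutator_mem_normal_swap)
  then have 2: "commutator G (commutator G (inv v) (inv x)) u \<in> ?K"
    using extend.IH[of "insert j I" "commutator G (inv v) (inv x)"] extend.prems by auto
  have "commutator G (commutator G u v) x \<in> ?K"
    using three_subgroup_mem[OF K x u v 1 2] .
  then show ?case
    using K x u v by (simp add: commutator_mem_normal_swap commutator_closed)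
qed

text \<open>
  The second argument is reduced to a generator, for which the preceding lemma applies; swapping the
  arguments turns this into the statement on generators in the first argument.
\<close>
lemma commutator_mem_sym_comm:
  assumes R: "\<And>i. i \<in> I \<union> J \<Longrightarrow> R i \<lhd> G"
    and x: "x \<in> sym_comm G R I" and y: "y \<in> sym_comm G R J"
  shows "commutator G x y \<in> sym_comm G R (I \<union> J)"
proof -
  have K: "sym_comm G R (I \<union> J) \<lhd> G" by (rule sym_comm_normal) (rule R)
  have xc: "x \<in> carrier G" using x R
    by (intro normal_mem_carrier[OF sym_comm_normal x]) simp
  have yc: "y \<in> carrier G" using y R
    by (intro normal_mem_carrier[OF sym_comm_normal y]) simp
  have "commutator G y x \<in> sym_comm G R (I \<union> J)"
  proof (rule commutator_generate_mem_normal[OF K])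
    show closed: "{y. left_normed G R J y} \<subseteq> carrier G"
      using left_normed_closed[of R J] R by auto
    fix z assume z: "z \<in> {y. left_normed G R J y}"
    then have "commutator G x z \<in> sym_comm G R (I \<union> J)"
      using R x by (intro commutator_left_normed_mem_sym_comm) auto
    then show "commutator G z x \<in> sym_comm G R (I \<union> J)"
      using K xc z closed by (intro commutator_mem_normal_swap[of _ x z]) auto
  next
    show "y \<in> generate G {y. left_normed G R J y}" using y by (simp add: sym_comm_def)
  qed (rule xc)
  then show ?thesis using K xc yc by (simp add: commutator_mem_normal_swap)
qed


section \<open>Bracket arrangements\<close>

text \<open>
  Since \<open>commutator_mem_sym_comm\<close> permits overlapping index sets, repeated entries in \<open>js\<close> need no
  special treatment, and the induction follows the bracketing.
\<close>
lemma bracket_arrangement_mem_sym_comm: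
  assumes "bracket_arrangement G t \<beta>" "length xs = t" "length js = t"
    and "\<And>j. j \<in> set js \<Longrightarrow> R j \<lhd> G"
    and "\<And>s. s < t \<Longrightarrow> xs ! s \<in> R (js ! s)"
  shows "\<beta> xs \<in> sym_comm G R (set js)"
  using assms
proof (induction arbitrary: xs js rule: bracket_arrangement.induct)
  case weight_one
  then obtain j where "js = [j]" by (auto simp: length_Suc_conv)
  then show ?case
    using weight_one by (auto intro!: left_normed_mem_sym_comm left_normed.single)
next
  case weight_two
  then obtain j k where js: "js = [j, k]" by (auto simp: length_Suc_conv numeral_2_eq_2)
  have "xs ! 0 \<in> R j" "xs ! 1 \<in> R k"
    using weight_two.prems(4)[of 0] weight_two.prems(4)[of 1] js by auto
  then have "commutator G (xs ! 0) (xs ! 1) \<in> sym_comm G R ({j} \<union> {k})"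
    using weight_two.prems(3) js
    by (intro commutator_mem_sym_comm left_normed_mem_sym_comm left_normed.single) auto
  moreover have "{j} \<union> {k} = set js" using js by auto
  ultimately show ?case by simp
next
  case (composite n k \<beta> \<gamma>)
  have "\<beta> (take k xs) \<in> sym_comm G R (set (take k js))"
    using composite.prems composite.hyps
    by (intro composite.IH) (auto dest: in_set_takeD)
  moreover have "\<gamma> (drop k xs) \<in> sym_comm G R (set (drop k js))"
    using composite.prems composite.hyps
    by (intro composite.IH) (auto dest: in_set_dropD)
  moreover have js: "set (take k js) \<union> set (drop k js) = set js"
    by (metis append_take_drop_id set_append)
  ultimately show ?case
    using commutator_mem_sym_comm[of "set (take k js)" "set (drop k js)" R] composite.prems(3)
    by (simp only: js)
qed

end

lemma left_normed_bracket_arrangement: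
  assumes "n \<ge> 1"
  shows "\<exists>\<beta>. bracket_arrangement G n \<beta> \<and>
    (\<forall>xs. length xs = n \<longrightarrow> \<beta> xs = foldl (commutator G) (hd xs) (tl xs))"
  using assms
proof (induction n rule: dec_induct)
  case base
  show ?case
    using bracket_arrangement.weight_one[of G]
    by (intro exI[of _ "\<lambda>xs. xs ! 0"]) (auto simp: length_Suc_conv)
next
  case (step n)
  then obtain \<beta> where \<beta>: "bracket_arrangement G n \<beta>"
    "\<And>xs. length xs = n \<Longrightarrow> \<beta> xs = foldl (commutator G) (hd xs) (tl xs)" by blast
  \<comment> \<open>Weight two is a separate rule, as composites have weight at least three.\<close>
  show ?case
  proof (cases "n = 1")
    case True
    then show ?thesis
      using bracket_arrangement.weight_two[of G]
      by (intro exI[of _ "\<lambda>xs. commutator G (xs ! 0) (xs ! 1)"])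
        (auto simp: length_Suc_conv numeral_2_eq_2)
  next
    case False
    let ?\<beta> = "\<lambda>xs. commutator G (\<beta> (take n xs)) ((\<lambda>ys. ys ! 0) (drop n xs))"
    have "bracket_arrangement G (Suc n) ?\<beta>"
      using bracket_arrangement.weight_one[of G] False step \<beta>(1)
      by (intro bracket_arrangement.composite) auto
    moreover have "?\<beta> xs = foldl (commutator G) (hd xs) (tl xs)" if len: "length xs = Suc n" for xs
    proof -
      obtain ys y where "xs = ys @ [y]" "length ys = n"
        using len by (auto simp: length_Suc_conv_rev)
      then show ?thesis using \<beta>(2) step by (cases ys) auto
    qed
    ultimately show ?thesis by blast
  qed
qed


section \<open>The product over all permutations\<close>

lemma left_normed_imp_foldl:
  assumes "left_normed G R I x"
  shows "\<exists>js g. js \<noteq> [] \<and> distinct js \<and> set js = I \<and> (\<forall>j\<in>I. g j \<in> R j) \<and>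
    x = foldl (commutator G) (g (hd js)) (map g (tl js))"
  using assms
proof (induction rule: left_normed.induct)
  case (single r j)
  then show ?case by (intro exI[of _ "[j]"] exI[of _ "\<lambda>_. r"]) auto
next
  case (extend I x j r)
  then obtain js g where js: "js \<noteq> []" "distinct js" "set js = I" "\<forall>j\<in>I. g j \<in> R j"
    and x: "x = foldl (commutator G) (g (hd js)) (map g (tl js))" by blast
  \<comment> \<open>Choosing the entry at the new index \<open>j\<close> leaves those at the indices in \<open>js\<close> unchanged.\<close>
  let ?g = "g(j := r)"
  have hd: "?g (hd js) = g (hd js)" and tl: "map ?g (tl js) = map g (tl js)"
    using js extend.hyps by (cases js; auto)+
  have "commutator G x r = foldl (commutator G) (?g (hd (js @ [j]))) (map ?g (tl (js @ [j])))"
    using js(1) by (simp add: hd tl x del: map_fun_upd fun_upd_apply add: fun_upd_same)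
  moreover have "\<forall>k\<in>insert j I. ?g k \<in> R k" using js extend.hyps by simp
  moreover have "js @ [j] \<noteq> []" "distinct (js @ [j])" "set (js @ [j]) = insert j I"
    using js extend.hyps by simp_all
  ultimately show ?case by blast
qed

lemma distinct_list_as_permutation:
  assumes "distinct js" "set js = {1..n}"
  shows "\<exists>\<sigma>. \<sigma> permutes {1..n} \<and> js = map \<sigma> [1..<Suc n]"
proof -
  have len: "length js = n" using assms distinct_card by fastforce
  define \<sigma> where "\<sigma> = (\<lambda>i. if i \<in> {1..n} then js ! (i - 1) else i)"
  have "bij_betw \<sigma> {1..n} {1..n}"
  proof (rule bij_betwI')
    fix i k assume "i \<in> {1..n}" "k \<in> {1..n}"
    then show "(\<sigma> i = \<sigma> k) = (i = k)"
      using assms len by (auto simp: \<sigma>_def nth_eq_iff_index_eq)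
  next
    fix i assume "i \<in> {1..n}"
    then have "js ! (i - 1) \<in> set js" using len by (intro nth_mem) auto
    then show "\<sigma> i \<in> {1..n}" using \<open>i \<in> {1..n}\<close> assms by (simp add: \<sigma>_def)
  next
    fix k assume "k \<in> {1..n}"
    then obtain i where "i < n" "k = js ! i"
      using assms len by (metis in_set_conv_nth)
    then show "\<exists>i\<in>{1..n}. k = \<sigma> i" by (intro bexI[of _ "Suc i"]) (auto simp: \<sigma>_def)
  qed
  then have "\<sigma> permutes {1..n}" by (rule bij_imp_permutes) (auto simp: \<sigma>_def)
  moreover have "js = map \<sigma> [1..<Suc n]"
    using len by (intro nth_equalityI) (auto simp: \<sigma>_def simp del: upt_Suc)
  ultimately show ?thesis by blast
qed

context group
begin

text \<open>
  A finite product of normal subgroups is their join in the lattice of subgroups. Only this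
  description is used, so that neither elements of the product nor the order of its factors occur.
\<close>
lemma finprod_normal_subgroups:
  assumes "finite A" "\<And>a. a \<in> A \<Longrightarrow> F a \<lhd> G"
  shows "finprod (normal_subgroup_monoid G) F A \<lhd> G"
    and "\<And>a. a \<in> A \<Longrightarrow> F a \<subseteq> finprod (normal_subgroup_monoid G) F A"
    and "\<And>H. \<lbrakk>subgroup H G; \<And>a. a \<in> A \<Longrightarrow> F a \<subseteq> H\<rbrakk> \<Longrightarrow>
      finprod (normal_subgroup_monoid G) F A \<subseteq> H"
proof -
  let ?M = "normal_subgroup_monoid G"
  interpret M: comm_monoid ?M by (rule comm_monoid_normal_subgroups)
  have "finprod ?M F A \<lhd> G \<and> (\<forall>a\<in>A. F a \<subseteq> finprod ?M F A) \<and>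
    (\<forall>H. subgroup H G \<longrightarrow> (\<forall>a\<in>A. F a \<subseteq> H) \<longrightarrow> finprod ?M F A \<subseteq> H)"
    using assms
  proof (induction rule: finite_induct)
    case empty
    have "finprod ?M F {} = {\<one>}"
      by (subst M.finprod_empty) (simp add: normal_subgroup_monoid_def)
    then show ?case by (auto simp: one_is_normal subgroup.one_closed)
  next
    case (insert a A)
    let ?P = "finprod ?M F A"
    have "finprod ?M F (insert a A) = F a \<otimes>\<^bsub>?M\<^esub> ?P"
      using insert.hyps insert.prems
      by (intro M.finprod_insert) (simp_all add: normal_subgroup_monoid_def)
    then have eq: "finprod ?M F (insert a A) = F a <#> ?P"
      by (simp add: normal_subgroup_monoid_def)
    have Fa: "F a \<lhd> G" by (rule insert.prems) simp
    have IH: "?P \<lhd> G" "\<forall>b\<in>A. F b \<subseteq> ?P"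
      "\<forall>H. subgroup H G \<longrightarrow> (\<forall>b\<in>A. F b \<subseteq> H) \<longrightarrow> ?P \<subseteq> H"
      using insert.IH insert.prems by simp_all
    interpret Fa: normal "F a" G by (rule Fa)
    interpret P: normal ?P G by (rule IH(1))
    have "F a <#> ?P \<lhd> G" using Fa IH(1) by (rule normal_subgroup_set_mult_closed)
    moreover have "F a \<subseteq> F a <#> ?P"
    proof
      fix x assume "x \<in> F a"
      then have "x \<otimes> \<one> \<in> F a <#> ?P" "x \<in> carrier G"
        using P.one_closed Fa.subset unfolding set_mult_def by blast+
      then show "x \<in> F a <#> ?P" by simp
    qed
    moreover have "?P \<subseteq> F a <#> ?P"
    proof
      fix x assume "x \<in> ?P"
      then have "\<one> \<otimes> x \<in> F a <#> ?P" "x \<in> carrier G"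
        using Fa.one_closed P.subset unfolding set_mult_def by blast+
      then show "x \<in> F a <#> ?P" by simp
    qed
    moreover have "F a <#> ?P \<subseteq> H" if H: "subgroup H G" "\<forall>b\<in>insert a A. F b \<subseteq> H" for H
    proof -
      have "?P \<subseteq> H" "F a \<subseteq> H" using IH(3) H by simp_all
      then show ?thesis using subgroup.m_closed[OF H(1)] unfolding set_mult_def by blast
    qed
    moreover have "\<forall>b\<in>A. F b \<subseteq> F a <#> ?P"
      using IH(2) \<open>?P \<subseteq> F a <#> ?P\<close> by blast
    ultimately show ?case unfolding eq by simp
  qed
  then show "finprod ?M F A \<lhd> G" "\<And>a. a \<in> A \<Longrightarrow> F a \<subseteq> finprod ?M F A"
    "\<And>H. \<lbrakk>subgroup H G; \<And>a. a \<in> A \<Longrightarrow> F a \<subseteq> H\<rbrakk> \<Longrightarrow> finprod ?M F A \<subseteq> H"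
    by blast+
qed

text \<open>
  The order in which a left-normed commutator uses the indices \<open>1, \<dots>, n\<close> is a permutation, and the
  commutator is a generator of the factor that belongs to this permutation.
\<close>
lemma sym_comm_subset_symmetric_commutator_subgroup:
  assumes n: "n > 1" and R: "\<And>i. i \<in> {1..n} \<Longrightarrow> R i \<lhd> G"
  shows "sym_comm G R {1..n} \<subseteq> symmetric_commutator_subgroup G n R"
proof -
  let ?L = "\<lambda>\<sigma>. left_commutator_subgroup G n (\<lambda>i. R (\<sigma> i))"
  let ?\<Sigma> = "{\<sigma>. \<sigma> permutes {1..n}}"
  let ?S = "symmetric_commutator_subgroup G n R"
  have S: "?S = finprod (normal_subgroup_monoid G) ?L ?\<Sigma>"
    using n by (simp add: symmetric_commutator_subgroup_def)
  have fin: "finite ?\<Sigma>" by (simp add: finite_permutations)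
  have L: "?L \<sigma> \<lhd> G" if "\<sigma> \<in> ?\<Sigma>" for \<sigma>
  proof (rule left_commutator_subgroup_normal)
    fix i assume "i \<in> {1..n}"
    then have "\<sigma> i \<in> {1..n}" using that permutes_in_image[of \<sigma>] by blast
    then show "R (\<sigma> i) \<lhd> G" by (rule R)
  qed (use n in simp)
  have "x \<in> ?S" if x: "left_normed G R {1..n} x" for x
  proof -
    obtain js g where js: "distinct js" "set js = {1..n}" and g: "\<forall>j\<in>{1..n}. g j \<in> R j"
      and x: "x = foldl (commutator G) (g (hd js)) (map g (tl js))"
      using left_normed_imp_foldl[OF x] by blast
    obtain \<sigma> where \<sigma>: "\<sigma> permutes {1..n}" and js_eq: "js = map \<sigma> [1..<Suc n]"
      using distinct_list_as_permutation[OF js] by blast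
    have "[1..<Suc n] = 1 # [2..<Suc n]"
      using n by (subst upt_conv_Cons) (auto simp: numeral_2_eq_2)
    then have "x = foldl (commutator G) ((g \<circ> \<sigma>) 1) (map (g \<circ> \<sigma>) [2..<Suc n])"
      using x js_eq by (simp del: upt_Suc)
    moreover have "\<forall>i\<in>{1..n}. (g \<circ> \<sigma>) i \<in> R (\<sigma> i)"
      using g \<sigma> by (metis comp_apply permutes_in_image)
    ultimately have "x \<in> ?L \<sigma>"
      unfolding left_commutator_subgroup_def by (intro generate.incl) blast
    then show ?thesis
      using finprod_normal_subgroups(2)[OF fin, of ?L \<sigma>] L \<sigma> S by auto
  qed
  moreover have "subgroup ?S G"
    unfolding S using finprod_normal_subgroups(1)[OF fin] L by (simp add: normal_imp_subgroup)
  ultimately show ?thesis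
    unfolding sym_comm_def by (intro generate_subgroup_incl) auto
qed

text \<open>
  Both claims rest on the same fact, that the generating bracket arrangements have their values in
  the subgroup \<open>sym_comm G R {1..n}\<close>; for the second, this places the generators in \<open>carrier G\<close>.
\<close>
lemma
  assumes n: "n > 1" and R: "\<And>i. i \<in> {1..n} \<Longrightarrow> R i \<lhd> G"
  shows fat_commutator_subgroup_subset: "fat_commutator_subgroup G n R \<subseteq> sym_comm G R {1..n}"
    and fat_commutator_subgroup_is_subgroup: "subgroup (fat_commutator_subgroup G n R) G"
proof -
  let ?B = "{\<beta> (map g [1..<Suc t]) | \<beta> t i g. t \<ge> n \<and> bracket_arrangement G t \<beta> \<and>
    i ` {1..t} = {1..n} \<and> (\<forall>s\<in>{1..t}. g s \<in> R (i s))}"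
  have fat: "fat_commutator_subgroup G n R = generate G ?B"
    using n by (simp add: fat_commutator_subgroup_def)
  have "\<beta> (map g [1..<Suc t]) \<in> sym_comm G R {1..n}"
    if "bracket_arrangement G t \<beta>" and i: "i ` {1..t} = {1..n}"
      and g: "\<forall>s\<in>{1..t}. g s \<in> R (i s)" for \<beta> t i g
  proof -
    have "set (map i [1..<Suc t]) = {1..n}"
      using i by (simp del: upt_Suc add: atLeastLessThanSuc_atLeastAtMost)
    then show ?thesis
      using bracket_arrangement_mem_sym_comm[OF that(1), of "map g [1..<Suc t]" "map i [1..<Suc t]" R]
        R g by (auto simp del: upt_Suc)
  qed
  then have B: "?B \<subseteq> sym_comm G R {1..n}" by blast
  have sub: "subgroup (sym_comm G R {1..n}) G"
    using R by (intro normal_imp_subgroup sym_comm_normal)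
  show "fat_commutator_subgroup G n R \<subseteq> sym_comm G R {1..n}"
    unfolding fat using B sub by (rule generate_subgroup_incl)
  show "subgroup (fat_commutator_subgroup G n R) G"
    unfolding fat using B subgroup.subset[OF sub] by (intro generate_is_subgroup) blast
qed

lemma left_commutator_subgroup_subset_fat:
  assumes n: "n > 1" and \<sigma>: "\<sigma> permutes {1..n}"
  shows "left_commutator_subgroup G n (\<lambda>i. R (\<sigma> i)) \<subseteq> fat_commutator_subgroup G n R"
proof -
  obtain \<beta> where \<beta>: "bracket_arrangement G n \<beta>"
    "\<And>xs. length xs = n \<Longrightarrow> \<beta> xs = foldl (commutator G) (hd xs) (tl xs)"
    using left_normed_bracket_arrangement[of n G] n by auto
  have "[1..<Suc n] = 1 # [2..<Suc n]"
    using n by (subst upt_conv_Cons) (auto simp: numeral_2_eq_2)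
  then have eq: "foldl (commutator G) (g 1) (map g [2..<Suc n]) = \<beta> (map g [1..<Suc n])" for g
    using n \<beta>(2)[of "map g [1..<Suc n]"] by (simp del: upt_Suc)
  let ?L = "{\<beta> (map g [1..<Suc n]) | g. \<forall>i\<in>{1..n}. g i \<in> R (\<sigma> i)}"
  let ?B = "{\<beta> (map g [1..<Suc t]) | \<beta> t i g. t \<ge> n \<and> bracket_arrangement G t \<beta> \<and>
    i ` {1..t} = {1..n} \<and> (\<forall>s\<in>{1..t}. g s \<in> R (i s))}"
  have "?L \<subseteq> ?B"
    using \<beta>(1) permutes_image[OF \<sigma>] order_refl[of n] by blast
  then have "generate G ?L \<subseteq> generate G ?B" by (rule mono_generate)
  then show ?thesis
    using n unfolding left_commutator_subgroup_def fat_commutator_subgroup_def eq by simp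
qed

end


section \<open>The fat and the symmetric commutator subgroup\<close>

theorem theorem1p1:
  fixes G :: "('a, 'b) monoid_scheme" and R :: "nat \<Rightarrow> 'a set" and n :: nat
  assumes "group G" and "n \<ge> 1" and "\<And>i. i \<in> {1..n} \<Longrightarrow> R i \<lhd> G"
  shows "fat_commutator_subgroup G n R = symmetric_commutator_subgroup G n R"
proof (cases "n = 1")
  case True
  then show ?thesis
    by (simp add: fat_commutator_subgroup_def symmetric_commutator_subgroup_def)
next
  case False
  interpret group G by fact
  have n: "n > 1" using False assms(2) by simp
  show ?thesis
  proof
    show "fat_commutator_subgroup G n R \<subseteq> symmetric_commutator_subgroup G n R"
      using fat_commutator_subgroup_subset[OF n assms(3)]
        sym_comm_subset_symmetric_commutator_subgroup[OF n assms(3)]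
      by (rule subset_trans)
    have "left_commutator_subgroup G n (\<lambda>i. R (\<sigma> i)) \<lhd> G" if "\<sigma> permutes {1..n}" for \<sigma>
    proof (rule left_commutator_subgroup_normal)
      fix i assume "i \<in> {1..n}"
      then have "\<sigma> i \<in> {1..n}" using that permutes_in_image[of \<sigma>] by blast
      then show "R (\<sigma> i) \<lhd> G" by (rule assms(3))
    qed (rule assms(2))
    then have "finprod (normal_subgroup_monoid G)
        (\<lambda>\<sigma>. left_commutator_subgroup G n (\<lambda>i. R (\<sigma> i))) {\<sigma>. \<sigma> permutes {1..n}}
      \<subseteq> fat_commutator_subgroup G n R"
      using left_commutator_subgroup_subset_fat[OF n]
        fat_commutator_subgroup_is_subgroup[OF n assms(3)]
      by (intro finprod_normal_subgroups(3)) (simp_all add: finite_permutations)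
    then show "symmetric_commutator_subgroup G n R \<subseteq> fat_commutator_subgroup G n R"
      using n by (simp add: symmetric_commutator_subgroup_def)
  qed
qed

end
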